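(* Let $\mathcal{X}$ be a real Hilbert space, let $f$, $g$, $\Psi=f+g$, $L_f>0$, $\mu_f,\mu_g\ge 0$ be as in the context, let $x^\star\in\arg\min\Psi$ and $\Psi^\star=\Psi(x^\star)$. Consider APGD (see context) with $0<\gamma\le\frac{1}{L_f}$, $a_0=0$, $a_t\geq 1$ for every $t\ge 1$, and $a_{t+1}^2-a_{t+1}\le a_t^2$ (equivalently $a_{t+1}\le \frac{1+\sqrt{1+4a_t^2}}{2}$) for every $t\ge 0$ (this implies $a_1=1$). Define, for $t\ge 0$, $$\mathcal{E}^t_{x^\star}:=\frac{1+a_{t}\gamma\mu_g}{2\gamma}\|z^{t}-x^\star\|^2+a_{t}^2\big(\Psi(x^{t})-\Psi^\star\big).$$ Then: (1) $\mathcal{E}^{t}_{x^\star}\le \mathcal{E}^0_{x^\star}=\frac{1}{2\gamma}\|x^0-x^\star\|^2$ for every $t\ge 0$, so that $\Psi(x^t)-\Psi^\star\le \frac{\|x^0-x^\star\|^2}{2\gamma a_t^2}$ for every $t\ge 1$. (2) In particular, with $\gamma=\frac1{L_f}$ and $a_t=\frac{t+1}{2}$ for every $t\ge 1$ (or with $a_t$ defined recursively by $a_{t+1}:=\frac{1+\sqrt{1+4a_t^2}}{2}$, $a_0=0$), which satisfy the condition above, one has for every $t\ge 1$ $$\Psi(x^t)-\Psi^\star\le \frac{2L_f\|x^0-x^\star\|^2}{(t+1)^2}.$$ (3) Suppose moreover that $\mu_g>0$, let $T\ge 1$, $\gamma=\frac{1}{L_f}$, and suppose $a_t=a_\sharp:=\max\big(\sqrt{L_f/\mu_g},1\big)$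 for every $t\ge T$. Then $\Psi$ has the unique minimizer $x^\star$ and $$\mathcal{E}^{t}_{x^\star}\le \left(\frac{1}{1+\sqrt{\mu_g/L_f}}\right)^{t-T}\mathcal{E}^T_{x^\star}\qquad\forall t\ge T,$$ hence the iteration complexity (number of iterations to reach $\mathcal{E}^t_{x^\star}\le\epsilon$) is $\mathcal{O}\big(\sqrt{L_f/\mu_g}\,\log\epsilon^{-1}\big)$ as $\epsilon\to 0$.
   Context: Setting: $\mathcal{X}$ is a real Hilbert space; $f:\mathcal{X}\to\mathbb{R}$ is convex, differentiable and $L_f$-smooth (i.e. $\nabla f$ is $L_f$-Lipschitz continuous) with $L_f>0$; $g:\mathcal{X}\to\mathbb{R}\cup\{+\infty\}$ is proper, lower semicontinuous and convex. For a convex function $\phi$, $\mu_\phi\ge 0$ denotes a constant such that $\phi-\frac{\mu_\phi}{2}\|\cdot\|^2$ is convex. $\Psi:=f+g$ is assumed to have a minimizer. $\mathrm{prox}_\phi(x):=\arg\min_{y}\{\phi(y)+\frac12\|y-x\|^2\}$. APGD: given $\gamma>0$, a real sequence $(a_t)_{t\ge0}$ with $a_t\ge 1$ for every $t\ge 1$, and $z^0=x^0\in\mathcal{X}$, iterate for $t\ge 0$: $y^{t}:=(1-\frac{1}{a_{t+1}})x^{t}+\frac{1}{a_{t+1}}z^{t}$; $z^{t+1}:=\mathrm{prox}_{a_{t+1}\gamma g}\big(z^t-a_{t+1}\gamma\nabla f(y^t)\big)$; $x^{t+1}:=(1-\frac{1}{a_{t+1}})x^{t}+\frac{1}{a_{t+1}}z^{t+1}$.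 Convention: $0\cdot(+\infty)=0$ (relevant if $\Psi(x^0)=+\infty$, since $a_0=0$). *)

theory Defs
  imports "HOL-Analysis.Analysis" "HOL-Library.Landau_Symbols"
begin

definition proper :: "('a \<Rightarrow> ereal) \<Rightarrow> bool" where
  "proper \<phi> \<longleftrightarrow> (\<forall>u. \<phi> u \<noteq> -\<infinity>) \<and> (\<exists>u. \<phi> u \<noteq> \<infinity>)"

definition lower_semicontinuous :: "('a::topological_space \<Rightarrow> ereal) \<Rightarrow> bool" where
  "lower_semicontinuous \<phi> \<longleftrightarrow> (\<forall>u. \<phi> u \<le> Liminf (at u) \<phi>)"

(* Only used for functions that never take the value -infinity, so that the right-hand side
   does not involve the sum of opposite infinities; in ereal, 0 * infinity = 0. *)
definition ereal_convex :: "('a::real_vector \<Rightarrow> ereal) \<Rightarrow> bool" where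
  "ereal_convex \<phi> \<longleftrightarrow>
     (\<forall>u v. \<forall>s\<in>{0..1::real}.
        \<phi> ((1 - s) *\<^sub>R u + s *\<^sub>R v) \<le> ereal (1 - s) * \<phi> u + ereal s * \<phi> v)"

definition prox :: "('a::real_normed_vector \<Rightarrow> ereal) \<Rightarrow> 'a \<Rightarrow> 'a" where
  "prox \<phi> u = (ARG_MIN (\<lambda>v. \<phi> v + ereal (1 / 2 * (norm (v - u))\<^sup>2)) v. True)"

definition objective :: "('a \<Rightarrow> real) \<Rightarrow> ('a \<Rightarrow> ereal) \<Rightarrow> 'a \<Rightarrow> ereal" where
  "objective f g u = ereal (f u) + g u"

(* f' is the gradient of f; mu_f and mu_g are strong convexity constants (possibly 0). *)
locale composite_problem =
  fixes f :: "'a::{real_inner, complete_space} \<Rightarrow> real"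
    and f' :: "'a \<Rightarrow> 'a"
    and g :: "'a \<Rightarrow> ereal"
    and L\<^sub>f \<mu>\<^sub>f \<mu>\<^sub>g :: real
    and xs :: 'a
  assumes f_convex: "convex_on UNIV f"
    and f_gradient: "GDERIV f u :> f' u"
    and L_pos: "L\<^sub>f > 0"
    and f_smooth: "L\<^sub>f-lipschitz_on UNIV f'"
    and g_proper: "proper g"
    and g_lsc: "lower_semicontinuous g"
    and g_convex: "ereal_convex g"
    and muf_nonneg: "\<mu>\<^sub>f \<ge> 0"
    and f_strongly_convex: "convex_on UNIV (\<lambda>u. f u - \<mu>\<^sub>f / 2 * (norm u)\<^sup>2)"
    and mug_nonneg: "\<mu>\<^sub>g \<ge> 0"
    and g_strongly_convex: "ereal_convex (\<lambda>u. g u - ereal (\<mu>\<^sub>g / 2 * (norm u)\<^sup>2))"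
    and xs_minimizer: "is_arg_min (objective f g) (\<lambda>_. True) xs"

definition apgd_coefficients :: "(nat \<Rightarrow> real) \<Rightarrow> bool" where
  "apgd_coefficients a \<longleftrightarrow>
     a 0 = 0 \<and> (\<forall>t\<ge>1. a t \<ge> 1) \<and> (\<forall>t. (a (t + 1))\<^sup>2 - a (t + 1) \<le> (a t)\<^sup>2)"

locale apgd = composite_problem f f' g L\<^sub>f \<mu>\<^sub>f \<mu>\<^sub>g xs
  for f :: "'a::{real_inner, complete_space} \<Rightarrow> real" and f' g L\<^sub>f \<mu>\<^sub>f \<mu>\<^sub>g xs +
  fixes \<gamma> :: real
    and a :: "nat \<Rightarrow> real"
    and x y z :: "nat \<Rightarrow> 'a"
  assumes gamma_pos: "0 < \<gamma>"
    and gamma_le: "\<gamma> \<le> 1 / L\<^sub>f"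
    and coefficients: "apgd_coefficients a"
    and start: "z 0 = x 0"
    and y_step: "y t = (1 - 1 / a (t + 1)) *\<^sub>R x t + (1 / a (t + 1)) *\<^sub>R z t"
    and z_step: "z (t + 1) =
      prox (\<lambda>u. ereal (a (t + 1) * \<gamma>) * g u) (z t - (a (t + 1) * \<gamma>) *\<^sub>R f' (y t))"
    and x_step: "x (t + 1) = (1 - 1 / a (t + 1)) *\<^sub>R x t + (1 / a (t + 1)) *\<^sub>R z (t + 1)"

(* For t = 0 the objective value may be infinite; since a 0 = 0 the product is then 0 in ereal. *)
definition energy ::
  "('a::real_normed_vector \<Rightarrow> real) \<Rightarrow> ('a \<Rightarrow> ereal) \<Rightarrow> real \<Rightarrow> 'a \<Rightarrow> real \<Rightarrow>
   (nat \<Rightarrow> real) \<Rightarrow> (nat \<Rightarrow> 'a) \<Rightarrow> (nat \<Rightarrow> 'a) \<Rightarrow> nat \<Rightarrow> ereal" where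
  "energy f g \<mu>\<^sub>g xs \<gamma> a x z t =
     ereal ((1 + a t * \<gamma> * \<mu>\<^sub>g) / (2 * \<gamma>) * (norm (z t - xs))\<^sup>2)
     + ereal ((a t)\<^sup>2) * (objective f g (x t) - objective f g xs)"

(* Meaningful only when the level eps is attained at some t. *)
definition iterations_to_reach :: "(nat \<Rightarrow> ereal) \<Rightarrow> real \<Rightarrow> nat" where
  "iterations_to_reach E \<epsilon> = (LEAST t. E t \<le> ereal \<epsilon>)"

definition half_coefficients :: "(nat \<Rightarrow> real) \<Rightarrow> bool" where
  "half_coefficients a \<longleftrightarrow> a 0 = 0 \<and> (\<forall>t\<ge>1. a t = (real t + 1) / 2)"

definition recursive_coefficients :: "(nat \<Rightarrow> real) \<Rightarrow> bool" where
  "recursive_coefficients a \<longleftrightarrow>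
     a 0 = 0 \<and> (\<forall>t. a (t + 1) = (1 + sqrt (1 + 4 * (a t)\<^sup>2)) / 2)"

definition a_sharp :: "real \<Rightarrow> real \<Rightarrow> real" where
  "a_sharp L\<^sub>f \<mu>\<^sub>g = max (sqrt (L\<^sub>f / \<mu>\<^sub>g)) 1"

end

theory Submission
  imports Defs "HOL-Real_Asymp.Real_Asymp"
begin

text \<open>Write A = a (t + 1). Since x (t + 1) - y t = (z (t + 1) - z t) / A, the
  descent lemma at y t, the gradient inequality of f from y t to x t and to the minimizer, and the
  optimality condition of the proximal step combine, after multiplication by A^2, into
  E (t + 1) \<le> \<parallel>z t - xs\<parallel>^2 / (2 \<gamma>) + (A^2 - A) (\<Psi> (x t) - \<Psi> xs).
  The condition A^2 - A \<le> (a t)^2 makes the energy decrease; for the constant coefficient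
  A = max (sqrt (L / \<mu>)) 1 the right-hand side is at most E t / (1 + sqrt (\<mu> / L)).
  The proximal points exist because optimality of xs for f + g gives g an affine minorant, so that
  no separation theorem is needed.\<close>

subsection \<open>Smooth and strongly convex functions\<close>

lemma deriv_along_line:
  fixes f :: "'a::real_inner \<Rightarrow> real"
  assumes "GDERIV f (u + t *\<^sub>R d) :> D"
  shows "((\<lambda>s. f (u + s *\<^sub>R d)) has_real_derivative (D \<bullet> d)) (at t)"
proof -
  have "((\<lambda>s. u + s *\<^sub>R d) has_derivative (\<lambda>h. h *\<^sub>R d)) (at t)"
    by (auto intro!: derivative_eq_intros)
  moreover have "(f has_derivative (\<lambda>h. h \<bullet> D)) (at (u + t *\<^sub>R d))"
    using assms by (simp add: gderiv_def)
  ultimately have "((\<lambda>s. f (u + s *\<^sub>R d)) has_derivative (\<lambda>h. (h *\<^sub>R d) \<bullet> D)) (at t)"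
    by (rule has_derivative_compose)
  then show ?thesis
    unfolding has_field_derivative_def
    by (rule has_derivative_eq_rhs) (auto simp: inner_commute)
qed

text \<open>On the line through u and v, f restricts to a convex function of one real variable,
  which lies above its tangent at 0.\<close>

lemma convex_gradient_inequality:
  fixes f :: "'a::real_inner \<Rightarrow> real"
  assumes "convex_on UNIV f" and D: "GDERIV f u :> D"
  shows "f u + D \<bullet> (v - u) \<le> f v"
proof -
  define h where "h s = f (u + s *\<^sub>R (v - u))" for s :: real
  have "convex_on UNIV h"
  proof (rule convex_onI)
    fix t r s :: real
    assume "0 < t" "t < 1"
    moreover have "u + ((1 - t) * r + t * s) *\<^sub>R (v - u) =
        (1 - t) *\<^sub>R (u + r *\<^sub>R (v - u)) + t *\<^sub>R (u + s *\<^sub>R (v - u))"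
      by (simp add: algebra_simps)
    ultimately show "h ((1 - t) *\<^sub>R r + t *\<^sub>R s) \<le> (1 - t) * h r + t * h s"
      using convex_onD[OF assms(1), of t] by (simp add: h_def)
  qed simp
  moreover have "(h has_real_derivative (D \<bullet> (v - u))) (at 0)"
    unfolding h_def using D by (intro deriv_along_line) simp
  ultimately have "h 1 - h 0 \<ge> (D \<bullet> (v - u)) * (1 - 0)"
    by (intro convex_on_imp_above_tangent[where A = UNIV]) auto
  then show ?thesis by (simp add: h_def)
qed

text \<open>The function \<open>h\<close> is f along the segment minus its linear part at u and the
  quadratic term. The Lipschitz bound makes its derivative nonpositive on [0,1], so monotonicity
  replaces integration of the gradient.\<close>

lemma descent_lemma:
  fixes f :: "'a::real_inner \<Rightarrow> real"
  assumes D: "\<And>u. GDERIV f u :> f' u" and lip: "L-lipschitz_on UNIV f'"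
  shows "f v \<le> f u + f' u \<bullet> (v - u) + L / 2 * (norm (v - u))\<^sup>2"
proof -
  define d where "d = v - u"
  define h where "h s = f (u + s *\<^sub>R d) - s * (f' u \<bullet> d) - L / 2 * s\<^sup>2 * (norm d)\<^sup>2" for s :: real
  have "h 1 \<le> h 0"
  proof (rule DERIV_nonpos_imp_nonincreasing[where f = h])
    fix t :: real
    assume "0 \<le> t" "t \<le> 1"
    have "(h has_real_derivative
        (f' (u + t *\<^sub>R d) \<bullet> d - f' u \<bullet> d - L * t * (norm d)\<^sup>2)) (at t)"
      unfolding h_def by (auto intro!: derivative_eq_intros deriv_along_line[OF D])
    moreover have "f' (u + t *\<^sub>R d) \<bullet> d - f' u \<bullet> d \<le> L * t * (norm d)\<^sup>2"
    proof -
      have "f' (u + t *\<^sub>R d) \<bullet> d - f' u \<bullet> d \<le> norm (f' (u + t *\<^sub>R d) - f' u) * norm d"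
        using norm_cauchy_schwarz[of "f' (u + t *\<^sub>R d) - f' u" d] by (simp add: inner_diff_left)
      also have "\<dots> \<le> (L * norm (t *\<^sub>R d)) * norm d"
        using lipschitz_onD[OF lip, of "u + t *\<^sub>R d" u]
        by (intro mult_right_mono) (auto simp: dist_norm)
      finally show ?thesis
        using \<open>0 \<le> t\<close> by (simp add: power2_eq_square mult_ac)
    qed
    ultimately show "\<exists>y. (h has_real_derivative y) (at t) \<and> y \<le> 0"
      by (intro exI[of _ "f' (u + t *\<^sub>R d) \<bullet> d - f' u \<bullet> d - L * t * (norm d)\<^sup>2"]) simp
  qed simp
  then show ?thesis by (simp add: h_def d_def)
qed

text \<open>This identity supplies the modulus term of strong convexity and, at s = 1/2, the
  parallelogram law for minimizing sequences.\<close>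

lemma norm_sq_convex_combination:
  fixes u v :: "'a::real_inner"
  shows "(norm ((1 - s) *\<^sub>R u + s *\<^sub>R v))\<^sup>2 =
    (1 - s) * (norm u)\<^sup>2 + s * (norm v)\<^sup>2 - s * (1 - s) * (norm (u - v))\<^sup>2"
  unfolding power2_norm_eq_inner
  by (simp add: inner_add_left inner_add_right inner_diff_left inner_diff_right inner_commute)
     algebra

lemma strongly_convex_combination:
  fixes g :: "'a::real_inner \<Rightarrow> ereal"
  assumes conv: "ereal_convex (\<lambda>u. g u - ereal (\<mu> / 2 * (norm u)\<^sup>2))"
    and u: "g u = ereal \<alpha>" and v: "g v = ereal \<beta>" and s: "0 \<le> s" "s \<le> 1"
  shows "g ((1 - s) *\<^sub>R u + s *\<^sub>R v) \<le>
    ereal ((1 - s) * \<alpha> + s * \<beta> - \<mu> / 2 * (s * (1 - s) * (norm (u - v))\<^sup>2))"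
proof -
  let ?w = "(1 - s) *\<^sub>R u + s *\<^sub>R v"
  let ?r = "(1 - s) * (\<alpha> - \<mu> / 2 * (norm u)\<^sup>2) + s * (\<beta> - \<mu> / 2 * (norm v)\<^sup>2)"
  have "g ?w - ereal (\<mu> / 2 * (norm ?w)\<^sup>2) \<le> ereal ?r"
    using conv[unfolded ereal_convex_def, rule_format, of s u v] s u v by simp
  then have "g ?w \<le> ereal (?r + \<mu> / 2 * (norm ?w)\<^sup>2)"
    by (cases "g ?w") auto
  also have "?r + \<mu> / 2 * (norm ?w)\<^sup>2 =
      (1 - s) * \<alpha> + s * \<beta> - \<mu> / 2 * (s * (1 - s) * (norm (u - v))\<^sup>2)"
    unfolding norm_sq_convex_combination by (simp add: field_simps)
  finally show ?thesis .
qed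

text \<open>Fermat's rule: -D is a strong subgradient of g at p. Along the segment from p to u,
  \<open>k\<close> + \<alpha> majorizes h + g, with equality at 0. If the claim failed,
  \<open>k\<close> would have negative slope at 0 and a nearby point would beat p.\<close>

lemma first_order_optimality:
  fixes g :: "'a::real_inner \<Rightarrow> ereal"
  assumes D: "GDERIV h p :> D"
    and conv: "ereal_convex (\<lambda>u. g u - ereal (\<mu> / 2 * (norm u)\<^sup>2))"
    and p: "g p = ereal \<alpha>" and u: "g u = ereal \<beta>"
    and minimal: "\<And>v. ereal (h p) + g p \<le> ereal (h v) + g v"
  shows "\<alpha> - D \<bullet> (u - p) + \<mu> / 2 * (norm (u - p))\<^sup>2 \<le> \<beta>"
proof (rule ccontr)
  assume contr: "\<not> ?thesis"
  define k where "k s = h (p + s *\<^sub>R (u - p)) + s * (\<beta> - \<alpha>)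
    - \<mu> / 2 * (s * (1 - s) * (norm (u - p))\<^sup>2)" for s :: real
  have "(k has_real_derivative (D \<bullet> (u - p) + (\<beta> - \<alpha>) - \<mu> / 2 * (norm (u - p))\<^sup>2)) (at 0)"
    unfolding k_def using D by (auto intro!: derivative_eq_intros deriv_along_line)
  then obtain d where d: "d > 0" "\<And>s. 0 < s \<Longrightarrow> s < d \<Longrightarrow> k s < k 0"
    using contr DERIV_neg_dec_right[of k _ 0] by force
  define s where "s = min (d / 2) 1"
  have s: "0 < s" "s < d" "s \<le> 1" using d(1) by (auto simp: s_def)
  let ?w = "(1 - s) *\<^sub>R p + s *\<^sub>R u"
  have "ereal (h p) + g p \<le> ereal (h ?w) + g ?w"
    by (rule minimal)
  also have "\<dots> \<le> ereal (h ?w) +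
      ereal ((1 - s) * \<alpha> + s * \<beta> - \<mu> / 2 * (s * (1 - s) * (norm (p - u))\<^sup>2))"
    using s by (intro add_left_mono strongly_convex_combination[OF conv p u]) auto
  finally have "h p \<le> h ?w + s * (\<beta> - \<alpha>) - \<mu> / 2 * (s * (1 - s) * (norm (u - p))\<^sup>2)"
    using p by (simp add: algebra_simps norm_minus_commute)
  moreover have "?w = p + s *\<^sub>R (u - p)"
    by (simp add: algebra_simps)
  ultimately have "k 0 \<le> k s"
    by (simp add: k_def)
  with d(2)[OF s(1,2)] show False by simp
qed

subsection \<open>Existence of proximal points\<close>

text \<open>A level c strictly between b and \<phi> p would lie below \<phi> near p but above \<phi>
  on the tail of the sequence.\<close>

lemma lower_semicontinuous_limit:
  fixes \<phi> :: "'a::t1_space \<Rightarrow> ereal"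
  assumes lsc: "lower_semicontinuous \<phi>" and v: "v \<longlonglongrightarrow> p" and lim: "(\<lambda>n. \<phi> (v n)) \<longlonglongrightarrow> b"
  shows "\<phi> p \<le> b"
proof (rule ccontr)
  assume "\<not> ?thesis"
  then obtain c where c: "b < c" "c < \<phi> p"
    using dense by (metis not_le)
  have "c < Liminf (at p) \<phi>"
    using c(2) lsc by (auto simp: lower_semicontinuous_def intro: less_le_trans)
  then have "\<forall>\<^sub>F u in at p. c < \<phi> u"
    by (rule less_LiminfD)
  \<comment> \<open>The filter \<open>at p\<close> omits p itself, which the sequence may visit; c <
    \<phi> p closes this hole.\<close>
  then have "\<forall>\<^sub>F u in nhds p. c < \<phi> u"
    using c(2) by (auto simp: eventually_at_filter elim: eventually_mono)
  then have "\<forall>\<^sub>F n in sequentially. c < \<phi> (v n)"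
    using v by (rule eventually_compose_filterlim)
  moreover have "\<forall>\<^sub>F n in sequentially. \<phi> (v n) < c"
    using lim c(1) by (rule order_tendstoD)
  ultimately have "\<forall>\<^sub>F n in sequentially. False"
    by eventually_elim simp
  then show False by simp
qed

text \<open>A minimizing sequence is Cauchy by the parallelogram law; the affine minorant only serves
  to bound the infimum from below.\<close>
lemma prox_exists:
  fixes g :: "'a::{real_inner, complete_space} \<Rightarrow> ereal"
  assumes proper: "proper g" and lsc: "lower_semicontinuous g" and conv: "ereal_convex g"
    and minorant: "\<And>u. ereal (\<alpha> + d \<bullet> u) \<le> g u" and c: "c > 0"
  shows "\<exists>p. is_arg_min (\<lambda>v. ereal c * g v + ereal (1 / 2 * (norm (v - w))\<^sup>2)) (\<lambda>_. True) p"
proof -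
  \<comment> \<open>The graph of the finite part of g: infima and estimates are then taken over real
    numbers.\<close>
  define S where "S = {(v, r). g v = ereal r}"
  define F where "F = (\<lambda>(v, r). c * r + 1 / 2 * (norm (v - w))\<^sup>2 :: real)"
  have g_cases: "(\<exists>r. (v, r) \<in> S) \<or> g v = \<infinity>" for v
    using proper by (cases "g v") (auto simp: S_def proper_def)
  have "S \<noteq> {}"
    using proper g_cases by (fastforce simp: proper_def)
  have bdd: "bdd_below (F ` S)"
  proof (rule bdd_belowI2)
    fix q assume "q \<in> S"
    then obtain v r where q: "q = (v, r)" "g v = ereal r" by (auto simp: S_def)
    have "c * (\<alpha> + d \<bullet> v) \<le> c * r"
      using minorant[of v] q c by (intro mult_left_mono) auto
    \<comment> \<open>Completing the square: half of this square absorbs the linear term c (d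
      \<bullet> v) of the scaled minorant.\<close>
    moreover have "0 \<le> (norm (v - w + c *\<^sub>R d))\<^sup>2" by simp
    then have "0 \<le> (norm (v - w))\<^sup>2 + 2 * c * (d \<bullet> v) - 2 * c * (d \<bullet> w) + c\<^sup>2 * (norm d)\<^sup>2"
      unfolding power2_norm_eq_inner
      by (simp add: inner_add_left inner_add_right inner_diff_left inner_diff_right inner_commute
          power2_eq_square algebra_simps)
    ultimately show "c * \<alpha> + c * (d \<bullet> w) - c\<^sup>2 * (norm d)\<^sup>2 / 2 \<le> F q"
      by (simp add: q F_def algebra_simps)
  qed
  define m where "m = Inf (F ` S)"
  have m_le: "m \<le> F q" if "q \<in> S" for q
    unfolding m_def using bdd that by (intro cInf_lower) auto
  have "\<exists>q\<in>S. F q < m + 1 / real (Suc n)" for n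
    using cInf_lessD[of "F ` S" "m + 1 / real (Suc n)"] \<open>S \<noteq> {}\<close> by (auto simp: m_def)
  then obtain Q where Q: "\<And>n. Q n \<in> S" "\<And>n. F (Q n) < m + 1 / real (Suc n)" by metis
  define v where "v n = fst (Q n)" for n
  define r where "r n = snd (Q n)" for n
  have vr: "g (v n) = ereal (r n)" "c * r n + 1 / 2 * (norm (v n - w))\<^sup>2 < m + 1 / real (Suc n)"
    "m \<le> c * r n + 1 / 2 * (norm (v n - w))\<^sup>2" for n
    using Q(1)[of n] Q(2)[of n] m_le[OF Q(1)[of n]]
    by (auto simp: S_def F_def v_def r_def split: prod.splits)
  have conv0: "ereal_convex (\<lambda>u. g u - ereal (0 / 2 * (norm u)\<^sup>2))"
    using conv by simp
  \<comment> \<open>The midpoint has value at least m, but at most the mean of the two values minus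
    1/8 of the squared distance. Both values are within 1 / (n + 1) of m, hence the factor
    4.\<close>
  have gap: "(norm (v i - v j))\<^sup>2 \<le> 4 * (1 / real (Suc i)) + 4 * (1 / real (Suc j))" for i j
  proof -
    let ?u = "(1 - 1/2) *\<^sub>R v i + (1/2) *\<^sub>R v j"
    have le: "g ?u \<le> ereal ((1 - 1/2) * r i + 1/2 * r j
        - 0 / 2 * (1/2 * (1 - 1/2) * (norm (v i - v j))\<^sup>2))"
      by (rule strongly_convex_combination[OF conv0 vr(1) vr(1)]) auto
    then obtain \<rho> where \<rho>: "g ?u = ereal \<rho>"
      using g_cases[of ?u] by (auto simp: S_def)
    have "m \<le> c * \<rho> + 1 / 2 * (norm (?u - w))\<^sup>2"
      using m_le[of "(?u, \<rho>)"] \<rho> by (simp add: S_def F_def)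
    moreover have "c * \<rho> \<le> c * ((r i + r j) / 2)"
      using le \<rho> c by (intro mult_left_mono) (auto simp: field_simps)
    then have "c * \<rho> \<le> 1/2 * (c * r i) + 1/2 * (c * r j)"
      by (simp add: algebra_simps add_divide_distrib)
    moreover have "?u - w = (1 - 1/2) *\<^sub>R (v i - w) + (1/2) *\<^sub>R (v j - w)"
    proof -
      have "w = (1 - 1/2) *\<^sub>R w + (1/2) *\<^sub>R w"
        by (simp flip: scaleR_add_left)
      then show ?thesis
        unfolding scaleR_diff_right by (metis add_diff_add)
    qed
    then have "(norm (?u - w))\<^sup>2 = 1/2 * (norm (v i - w))\<^sup>2 + 1/2 * (norm (v j - w))\<^sup>2
        - 1/4 * (norm (v i - v j))\<^sup>2"
      by (simp only: norm_sq_convex_combination) simp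
    ultimately show ?thesis
      using vr(2)[of i] vr(2)[of j] by linarith
  qed
  have "Cauchy v"
  proof (rule metric_CauchyI)
    fix e :: real assume "0 < e"
    then obtain N where N: "1 / real (Suc N) < e\<^sup>2 / 8"
      using nat_approx_posE[of "e\<^sup>2 / 8"] by auto
    show "\<exists>M. \<forall>i\<ge>M. \<forall>j\<ge>M. dist (v i) (v j) < e"
    proof (intro exI[of _ N] allI impI)
      fix i j assume "i \<ge> N" "j \<ge> N"
      then have "1 / real (Suc i) \<le> 1 / real (Suc N)" "1 / real (Suc j) \<le> 1 / real (Suc N)"
        by (auto simp: field_simps)
      then have "(norm (v i - v j))\<^sup>2 < e\<^sup>2"
        using gap[of i j] N by linarith
      then show "dist (v i) (v j) < e"
        using \<open>0 < e\<close> by (simp add: dist_norm power2_less_imp_less)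
    qed
  qed
  then obtain p where p: "v \<longlonglongrightarrow> p"
    using Cauchy_convergent convergent_def by blast
  have "(\<lambda>n. c * r n + 1 / 2 * (norm (v n - w))\<^sup>2) \<longlonglongrightarrow> m"
  proof (rule tendsto_sandwich[where f = "\<lambda>_. m" and h = "\<lambda>n. m + 1 / real (Suc n)"])
    show "(\<lambda>n. m + 1 / real (Suc n)) \<longlonglongrightarrow> m"
      using tendsto_add[OF tendsto_const LIMSEQ_Suc[OF lim_1_over_n], of m] by simp
    show "\<forall>\<^sub>F n in sequentially. c * r n + 1 / 2 * (norm (v n - w))\<^sup>2 \<le> m + 1 / real (Suc n)"
      using less_imp_le[OF vr(2)] by (intro always_eventually allI)
  qed (use vr(3) in auto)
  moreover have "(\<lambda>n. 1 / 2 * (norm (v n - w))\<^sup>2) \<longlonglongrightarrow> 1 / 2 * (norm (p - w))\<^sup>2"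
    by (intro tendsto_intros p)
  \<comment> \<open>Solving for \<open>r n\<close> shows that g itself converges along the sequence,
    so its lower semicontinuity applies directly.\<close>
  ultimately have "(\<lambda>n. (c * r n + 1 / 2 * (norm (v n - w))\<^sup>2 - 1 / 2 * (norm (v n - w))\<^sup>2) / c)
      \<longlonglongrightarrow> (m - 1 / 2 * (norm (p - w))\<^sup>2) / c"
    by (intro tendsto_diff tendsto_divide tendsto_const) (use c in auto)
  then have "(\<lambda>n. g (v n)) \<longlonglongrightarrow> ereal ((m - 1 / 2 * (norm (p - w))\<^sup>2) / c)"
    using c by (simp add: vr(1))
  then have "g p \<le> ereal ((m - 1 / 2 * (norm (p - w))\<^sup>2) / c)"
    by (rule lower_semicontinuous_limit[OF lsc p])
  then obtain \<rho> where \<rho>: "g p = ereal \<rho>" "c * \<rho> \<le> m - 1 / 2 * (norm (p - w))\<^sup>2"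
    using g_cases[of p] c by (auto simp: S_def field_simps)
  have "ereal c * g p + ereal (1 / 2 * (norm (p - w))\<^sup>2)
      \<le> ereal c * g u + ereal (1 / 2 * (norm (u - w))\<^sup>2)" for u
    using g_cases[of u]
  proof
    assume "\<exists>r. (u, r) \<in> S"
    then obtain r where r: "(u, r) \<in> S" ..
    show ?thesis
      using m_le[OF r] r \<rho> by (simp add: S_def F_def)
  qed (use c in simp)
  then show ?thesis
    by (auto simp: is_arg_min_def not_less)
qed

text \<open>\<open>ARG_MIN\<close> is a choice operator, so \<open>prox\<close> is a minimizer only
  once one is known to exist.\<close>

lemma is_arg_min_prox:
  assumes "\<exists>p. is_arg_min (\<lambda>v. \<phi> v + ereal (1 / 2 * (norm (v - u))\<^sup>2)) (\<lambda>_. True) p"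
  shows "is_arg_min (\<lambda>v. \<phi> v + ereal (1 / 2 * (norm (v - u))\<^sup>2)) (\<lambda>_. True) (prox \<phi> u)"
  using someI_ex[OF assms] by (simp add: prox_def arg_min_def)

section \<open>Optimality at the minimizer and at proximal points\<close>

context composite_problem
begin

lemma g_not_MInf [simp]: "g u \<noteq> -\<infinity>"
  using g_proper by (simp add: proper_def)

lemma minimizer_finite:
  assumes "is_arg_min (objective f g) (\<lambda>_. True) u"
  shows "\<bar>g u\<bar> \<noteq> \<infinity>"
proof -
  obtain v where "g v \<noteq> \<infinity>"
    using g_proper by (auto simp: proper_def)
  moreover have "objective f g u \<le> objective f g v"
    using assms by (auto simp: is_arg_min_def not_less)
  ultimately show ?thesis
    by (auto simp: objective_def)
qed

text \<open>Fermat's rule at xs with f as the smooth part. The affine part provides the minorant for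
  the existence of proximal points, the quadratic part the growth of the objective.\<close>

lemma g_quadratic_minorant:
  "ereal (real_of_ereal (g xs) - f' xs \<bullet> (u - xs) + \<mu>\<^sub>g / 2 * (norm (u - xs))\<^sup>2) \<le> g u"
proof (cases "g u")
  case (real \<beta>)
  have "real_of_ereal (g xs) - f' xs \<bullet> (u - xs) + \<mu>\<^sub>g / 2 * (norm (u - xs))\<^sup>2 \<le> \<beta>"
  proof (rule first_order_optimality[OF f_gradient g_strongly_convex _ real])
    show "g xs = ereal (real_of_ereal (g xs))"
      using minimizer_finite[OF xs_minimizer] by (simp add: ereal_real)
    show "ereal (f xs) + g xs \<le> ereal (f v) + g v" for v
      using xs_minimizer by (auto simp: is_arg_min_def not_less objective_def)
  qed
  with real show ?thesis by simp
qed simp_all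

text \<open>The linear terms of the minorant of g and of the gradient inequality of f at xs
  cancel.\<close>

lemma objective_quadratic_growth:
  "objective f g xs + ereal (\<mu>\<^sub>g / 2 * (norm (u - xs))\<^sup>2) \<le> objective f g u"
proof -
  obtain \<alpha> where "g xs = ereal \<alpha>"
    using minimizer_finite[OF xs_minimizer] by (cases "g xs") auto
  then show ?thesis
    using g_quadratic_minorant[of u] convex_gradient_inequality[OF f_convex f_gradient, of xs u]
    by (cases "g u") (auto simp: objective_def)
qed

lemma unique_minimizer:
  assumes "\<mu>\<^sub>g > 0"
  shows "{u. is_arg_min (objective f g) (\<lambda>_. True) u} = {xs}"
proof -
  have "u = xs" if "is_arg_min (objective f g) (\<lambda>_. True) u" for u
  proof -
    have "objective f g u \<le> objective f g xs"
      using that by (auto simp: is_arg_min_def not_less)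
    with objective_quadratic_growth[of u] minimizer_finite[OF xs_minimizer] minimizer_finite[OF that]
    have "\<mu>\<^sub>g / 2 * (norm (u - xs))\<^sup>2 \<le> 0"
      by (cases "g xs"; cases "g u") (auto simp: objective_def)
    with assms show ?thesis
      by (simp add: mult_le_0_iff)
  qed
  with xs_minimizer show ?thesis by blast
qed

text \<open>(w - p) / c is a strong subgradient of g at p; the inequality is stated after
  multiplication by c.\<close>

lemma prox_inequality:
  assumes c: "c > 0" and p: "p = prox (\<lambda>u. ereal c * g u) w"
  shows "\<bar>g p\<bar> \<noteq> \<infinity>"
    and "g u = ereal \<beta> \<Longrightarrow> c * real_of_ereal (g p) + (w - p) \<bullet> (u - p)
      + c * \<mu>\<^sub>g / 2 * (norm (u - p))\<^sup>2 \<le> c * \<beta>"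
proof -
  have "is_arg_min (\<lambda>v. ereal c * g v + ereal (1 / 2 * (norm (v - w))\<^sup>2)) (\<lambda>_. True) p"
    unfolding p
  proof (intro is_arg_min_prox prox_exists g_proper g_lsc g_convex)
    fix u
    have "ereal (real_of_ereal (g xs) + f' xs \<bullet> xs + (- f' xs) \<bullet> u)
      \<le> ereal (real_of_ereal (g xs) - f' xs \<bullet> (u - xs) + \<mu>\<^sub>g / 2 * (norm (u - xs))\<^sup>2)"
      using mug_nonneg by (simp add: inner_diff_right)
    also note g_quadratic_minorant
    finally show "ereal (real_of_ereal (g xs) + f' xs \<bullet> xs + (- f' xs) \<bullet> u) \<le> g u" .
  qed (rule c)
  then have min: "ereal c * g p + ereal (1 / 2 * (norm (p - w))\<^sup>2)
      \<le> ereal c * g v + ereal (1 / 2 * (norm (v - w))\<^sup>2)" for v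
    by (auto simp: is_arg_min_def not_less)
  \<comment> \<open>Comparison with xs, where the proximal objective is finite.\<close>
  show fin: "\<bar>g p\<bar> \<noteq> \<infinity>"
    using min[of xs] minimizer_finite[OF xs_minimizer] c by (cases "g xs"; cases "g p") auto
  assume u: "g u = ereal \<beta>"
  obtain \<alpha> where \<alpha>: "g p = ereal \<alpha>"
    using fin by (cases "g p") auto
  \<comment> \<open>Dividing the proximal objective by c leaves g with coefficient 1, so that its
    own modulus \<open>\<mu>\<^sub>g\<close> can be used.\<close>
  let ?h = "\<lambda>v. 1 / (2 * c) * (norm (v - w))\<^sup>2"
  have "\<alpha> - ((1 / c) *\<^sub>R (p - w)) \<bullet> (u - p) + \<mu>\<^sub>g / 2 * (norm (u - p))\<^sup>2 \<le> \<beta>"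
  proof (rule first_order_optimality[OF _ g_strongly_convex \<alpha> u])
    show "GDERIV ?h p :> (1 / c) *\<^sub>R (p - w)"
      unfolding gderiv_def power2_norm_eq_inner using c
      by (auto intro!: derivative_eq_intros simp: inner_commute)
    show "ereal (?h p) + g p \<le> ereal (?h v) + g v" for v
    proof (cases "g v")
      case (real r)
      then have "(c * \<alpha> + 1 / 2 * (norm (p - w))\<^sup>2) / c \<le> (c * r + 1 / 2 * (norm (v - w))\<^sup>2) / c"
        using min[of v] \<alpha> c by (intro divide_right_mono) auto
      with real \<alpha> c show ?thesis by (simp add: add_divide_distrib mult.commute add.commute)
    qed simp_all
  qed
  then have "c * (\<alpha> - ((1 / c) *\<^sub>R (p - w)) \<bullet> (u - p) + \<mu>\<^sub>g / 2 * (norm (u - p))\<^sup>2) \<le> c * \<beta>"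
    using c by (intro mult_left_mono) auto
  also have "c * (\<alpha> - ((1 / c) *\<^sub>R (p - w)) \<bullet> (u - p) + \<mu>\<^sub>g / 2 * (norm (u - p))\<^sup>2)
      = c * \<alpha> + (w - p) \<bullet> (u - p) + c * \<mu>\<^sub>g / 2 * (norm (u - p))\<^sup>2"
    using c by (simp add: inner_diff_left field_simps)
  finally show "c * real_of_ereal (g p) + (w - p) \<bullet> (u - p)
      + c * \<mu>\<^sub>g / 2 * (norm (u - p))\<^sup>2 \<le> c * \<beta>"
    using \<alpha> by simp
qed

end

subsection \<open>The energy inequality\<close>

context apgd
begin

text \<open>\<open>real_of_ereal\<close> sends infinity to 0, so this is not the true gap at x 0
  when g is infinite there; at x 0 it only ever enters with weight 0.\<close>

definition gap :: "'a \<Rightarrow> real" where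
  "gap u = (f u + real_of_ereal (g u)) - (f xs + real_of_ereal (g xs))"

definition real_energy :: "nat \<Rightarrow> real" where
  "real_energy t = (1 + a t * \<gamma> * \<mu>\<^sub>g) / (2 * \<gamma>) * (norm (z t - xs))\<^sup>2 + (a t)\<^sup>2 * gap (x t)"

lemma a_0: "a 0 = 0" and a_ge_1: "t \<ge> 1 \<Longrightarrow> a t \<ge> 1"
  and a_step: "(a (Suc t))\<^sup>2 - a (Suc t) \<le> (a t)\<^sup>2"
  using coefficients by (auto simp: apgd_coefficients_def)

lemma a_1: "a 1 = 1"
proof -
  have "a 1 * (a 1 - 1) \<le> 0"
    using a_step[of 0] a_0 by (simp add: power2_eq_square algebra_simps)
  with a_ge_1[of 1] show ?thesis by (simp add: mult_le_0_iff)
qed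

lemma a_nonneg: "a t \<ge> 0"
  using a_0 a_ge_1[of t] by (cases "t = 0") auto

lemma g_xs: "g xs = ereal (real_of_ereal (g xs))"
  using minimizer_finite[OF xs_minimizer] by (simp add: ereal_real)

lemma g_z: "g (z (Suc t)) = ereal (real_of_ereal (g (z (Suc t))))"
  using prox_inequality(1)[OF _ z_step[of t]] a_ge_1[of "Suc t"] gamma_pos by (simp add: ereal_real)

text \<open>For t = 0 the value of g at x t may be infinite, but then the weight of x t is 0.\<close>
lemma g_x_step:
  assumes "\<bar>g (x t)\<bar> \<noteq> \<infinity> \<or> a (Suc t) = 1"
  shows "g (x (Suc t)) \<le> ereal ((1 - 1 / a (Suc t)) * real_of_ereal (g (x t))
    + (1 / a (Suc t)) * real_of_ereal (g (z (Suc t))))"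
proof (cases "a (Suc t) = 1")
  case True
  then show ?thesis using x_step[of t] g_z[of t] by simp
next
  case False
  then have "g (x t) = ereal (real_of_ereal (g (x t)))"
    using assms by (simp add: ereal_real)
  moreover have "ereal_convex (\<lambda>u. g u - ereal (0 / 2 * (norm u)\<^sup>2))"
    using g_convex by simp
  moreover have "0 \<le> 1 / a (Suc t)" "1 / a (Suc t) \<le> 1"
    using a_ge_1[of "Suc t"] by auto
  ultimately show ?thesis
    using strongly_convex_combination[of g 0 "x t" _ "z (Suc t)" _ "1 / a (Suc t)"] g_z x_step[of t]
    by fastforce
qed

lemma g_x_finite: "\<bar>g (x (Suc t))\<bar> \<noteq> \<infinity>"
proof (induction t)
  case 0
  \<comment> \<open>Since \<open>a 1 = 1\<close>, the first iterate is z 1, a proximal point,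
    whatever g is at x 0.\<close>
  then show ?case using g_x_step[of 0] a_1 by auto
next
  case (Suc t)
  then show ?case using g_x_step[of "Suc t"] by auto
qed

lemma g_x_finite_or_initial: "\<bar>g (x t)\<bar> \<noteq> \<infinity> \<or> a (Suc t) = 1"
  using g_x_finite a_1 by (cases t) auto

text \<open>Transfers everything to real arithmetic. For t = 0 the convention 0 times infinity = 0
  matches the weight \<open>a 0 = 0\<close>.\<close>

lemma energy_eq: "energy f g \<mu>\<^sub>g xs \<gamma> a x z t = ereal (real_energy t)"
proof (cases t)
  case 0
  have "ereal ((a 0)\<^sup>2) * (objective f g (x 0) - objective f g xs) = 0"
    by (simp add: a_0 flip: zero_ereal_def)
  then show ?thesis
    by (simp only: 0 energy_def real_energy_def) (simp add: a_0)
next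
  case (Suc s)
  then show ?thesis
    using g_xs g_x_finite[of s]
    by (cases "g xs"; cases "g (x t)")
       (auto simp: energy_def real_energy_def gap_def objective_def)
qed

lemma objective_gap:
  assumes "t \<ge> 1"
  shows "objective f g (x t) - objective f g xs = ereal (gap (x t))"
  using assms g_xs g_x_finite[of "t - 1"]
  by (cases "g xs"; cases "g (x t)") (auto simp: gap_def objective_def)

lemma gap_nonneg:
  assumes "t \<ge> 1"
  shows "gap (x t) \<ge> 0"
proof -
  have "objective f g xs \<le> objective f g (x t)"
    using xs_minimizer by (auto simp: is_arg_min_def not_less)
  then show ?thesis
    using assms g_xs g_x_finite[of "t - 1"]
    by (cases "g xs"; cases "g (x t)") (auto simp: gap_def objective_def)
qed

text \<open>The right-hand side is kept separate from the energy at t: both the monotone decrease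
  and the linear contraction come from comparing it with that energy.\<close>

lemma energy_step:
  "real_energy (Suc t) \<le>
    1 / (2 * \<gamma>) * (norm (z t - xs))\<^sup>2 + ((a (Suc t))\<^sup>2 - a (Suc t)) * gap (x t)"
proof -
  define A where "A = a (Suc t)"
  define D where "D = f' (y t)"
  define p where "p = z (Suc t)"
  define n where "n = (norm (p - z t))\<^sup>2"
  define G where "G u = real_of_ereal (g u)" for u
  have A: "A \<ge> 1" using a_ge_1[of "Suc t"] by (simp add: A_def)
  have y: "A *\<^sub>R y t = (A - 1) *\<^sub>R x t + z t"
    using arg_cong[OF y_step[of t], of "scaleR A"] A
    by (simp add: A_def scaleR_add_right right_diff_distrib)
  have x: "A *\<^sub>R x (Suc t) = (A - 1) *\<^sub>R x t + p"
    using arg_cong[OF x_step[of t], of "scaleR A"] A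
    by (simp add: A_def p_def scaleR_add_right right_diff_distrib)
  have diff: "A *\<^sub>R (x (Suc t) - y t) = p - z t"
    by (simp add: scaleR_diff_right x y)
  \<comment> \<open>The descent lemma times A^2; \<open>diff\<close> absorbs the factors A into p -
    z t, and \<gamma> \<le> 1 / L bounds the quadratic term by n / (2 \<gamma>).\<close>
  have f1: "A\<^sup>2 * f (x (Suc t)) \<le> A\<^sup>2 * f (y t) + A * (D \<bullet> (p - z t)) + 1 / (2 * \<gamma>) * n"
  proof -
    have "A\<^sup>2 * f (x (Suc t)) \<le> A\<^sup>2 * (f (y t) + D \<bullet> (x (Suc t) - y t)
        + L\<^sub>f / 2 * (norm (x (Suc t) - y t))\<^sup>2)"
      unfolding D_def by (intro mult_left_mono descent_lemma f_gradient f_smooth) simp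
    also have "\<dots> = A\<^sup>2 * f (y t) + A * (D \<bullet> (A *\<^sub>R (x (Suc t) - y t)))
        + L\<^sub>f / 2 * (norm (A *\<^sub>R (x (Suc t) - y t)))\<^sup>2"
      unfolding norm_scaleR power_mult_distrib inner_scaleR_right power2_abs
      by (simp add: power2_eq_square distrib_left mult_ac)
    also have "\<dots> \<le> A\<^sup>2 * f (y t) + A * (D \<bullet> (p - z t)) + 1 / (2 * \<gamma>) * n"
    proof -
      have "L\<^sub>f / 2 \<le> 1 / (2 * \<gamma>)"
        using gamma_le gamma_pos L_pos by (simp add: field_simps)
      then have "L\<^sub>f / 2 * n \<le> 1 / (2 * \<gamma>) * n"
        by (rule mult_right_mono) (simp add: n_def)
      then show ?thesis by (simp add: diff n_def)
    qed
    finally show ?thesis .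
  qed
  \<comment> \<open>The nonnegative weights A^2 - A and A, here and in \<open>f3\<close>, add up to
    the weight A^2 of f (y t) in \<open>f1\<close>.\<close>
  have f2: "(A\<^sup>2 - A) * (f (y t) + D \<bullet> (x t - y t)) \<le> (A\<^sup>2 - A) * f (x t)"
    using A convex_gradient_inequality[OF f_convex f_gradient, of "y t" "x t"]
    by (intro mult_left_mono) (auto simp: D_def power2_eq_square)
  have f3: "A * (f (y t) + D \<bullet> (xs - y t)) \<le> A * f xs"
    using A convex_gradient_inequality[OF f_convex f_gradient, of "y t" xs]
    by (intro mult_left_mono) (auto simp: D_def)
  have g1: "A\<^sup>2 * G (x (Suc t)) \<le> (A\<^sup>2 - A) * G (x t) + A * G p"
  proof -
    have "G (x (Suc t)) \<le> (1 - 1 / A) * G (x t) + (1 / A) * G p"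
      using g_x_step[OF g_x_finite_or_initial[of t]] g_x_finite[of t]
      by (cases "g (x (Suc t))") (auto simp: G_def A_def p_def)
    then have "A\<^sup>2 * G (x (Suc t)) \<le> A\<^sup>2 * ((1 - 1 / A) * G (x t) + (1 / A) * G p)"
      by (intro mult_left_mono) auto
    also have "\<dots> = (A\<^sup>2 - A) * G (x t) + A * G p"
      using A by (simp add: field_simps power2_eq_square)
    finally show ?thesis .
  qed
  \<comment> \<open>The proximal inequality with c = A \<gamma>, tested at xs and divided by
    \<gamma>.\<close>
  have g2: "A * G p + (1 / \<gamma>) * ((z t - p) \<bullet> (xs - p)) - A * (D \<bullet> (xs - p))
      + A * \<mu>\<^sub>g / 2 * (norm (p - xs))\<^sup>2 \<le> A * G xs"
  proof -
    have "A * \<gamma> * G p + (z t - (A * \<gamma>) *\<^sub>R D - p) \<bullet> (xs - p)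
        + A * \<gamma> * \<mu>\<^sub>g / 2 * (norm (xs - p))\<^sup>2 \<le> A * \<gamma> * G xs"
      unfolding G_def
      by (rule prox_inequality(2)[OF _ _ g_xs])
         (use A gamma_pos z_step[of t] in \<open>auto simp: A_def D_def p_def\<close>)
    then have "(A * \<gamma> * G p + (z t - (A * \<gamma>) *\<^sub>R D - p) \<bullet> (xs - p)
        + A * \<gamma> * \<mu>\<^sub>g / 2 * (norm (xs - p))\<^sup>2) / \<gamma> \<le> A * \<gamma> * G xs / \<gamma>"
      using gamma_pos by (intro divide_right_mono) auto
    moreover have "(z t - (A * \<gamma>) *\<^sub>R D - p) \<bullet> (xs - p)
        = (z t - p) \<bullet> (xs - p) - A * \<gamma> * (D \<bullet> (xs - p))"
      by (simp add: inner_diff_left)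
    ultimately show ?thesis
      using gamma_pos
      by (simp add: add_divide_distrib diff_divide_distrib norm_minus_commute[of p])
  qed
  \<comment> \<open>Polarization; its term n / (2 \<gamma>) cancels the one in
    \<open>f1\<close>.\<close>
  have inn: "(1 / \<gamma>) * ((z t - p) \<bullet> (xs - p)) =
      1 / (2 * \<gamma>) * (norm (p - xs))\<^sup>2 + 1 / (2 * \<gamma>) * n - 1 / (2 * \<gamma>) * (norm (z t - xs))\<^sup>2"
  proof -
    have "(z t - p) \<bullet> (xs - p) = ((norm (p - xs))\<^sup>2 + n - (norm (z t - xs))\<^sup>2) / 2"
      unfolding n_def power2_norm_eq_inner
      by (simp add: inner_diff_left inner_diff_right inner_commute)
    then show ?thesis
      by (simp add: add_divide_distrib diff_divide_distrib)
  qed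
  \<comment> \<open>By the definition of y t, (A^2 - A) (x t - y t) + A (xs - y t) = A (xs - z t),
    so the gradient terms of \<open>f2\<close>, \<open>f3\<close>, \<open>f1\<close> and
    \<open>g2\<close> cancel.\<close>
  have f23: "A\<^sup>2 * f (y t) + A * (D \<bullet> (xs - p)) + A * (D \<bullet> (p - z t))
      \<le> (A\<^sup>2 - A) * f (x t) + A * f xs"
  proof -
    have "A * (D \<bullet> y t) = (A - 1) * (D \<bullet> x t) + D \<bullet> z t"
      using arg_cong[OF y, of "inner D"] by (simp add: inner_add_right)
    then have "A * (A * (D \<bullet> y t)) = A * ((A - 1) * (D \<bullet> x t) + D \<bullet> z t)"
      by simp
    then show ?thesis
      using f2 f3 by (simp add: inner_diff_right power2_eq_square algebra_simps)
  qed
  have "1 / (2 * \<gamma>) * (norm (p - xs))\<^sup>2 + A * \<mu>\<^sub>g / 2 * (norm (p - xs))\<^sup>2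
      + A\<^sup>2 * f (x (Suc t)) + A\<^sup>2 * G (x (Suc t))
      \<le> 1 / (2 * \<gamma>) * (norm (z t - xs))\<^sup>2 + (A\<^sup>2 - A) * f (x t) + (A\<^sup>2 - A) * G (x t)
        + A * f xs + A * G xs"
    using f1 f23 g1 g2 inn by linarith
  moreover have "(1 + A * \<gamma> * \<mu>\<^sub>g) / (2 * \<gamma>) = 1 / (2 * \<gamma>) + A * \<mu>\<^sub>g / 2"
    using gamma_pos by (simp add: field_simps)
  then have "real_energy (Suc t) = 1 / (2 * \<gamma>) * (norm (p - xs))\<^sup>2
      + A * \<mu>\<^sub>g / 2 * (norm (p - xs))\<^sup>2 + A\<^sup>2 * f (x (Suc t)) + A\<^sup>2 * G (x (Suc t))
      - A\<^sup>2 * f xs - A\<^sup>2 * G xs"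
    by (simp add: real_energy_def gap_def G_def flip: A_def p_def) (simp add: algebra_simps)
  ultimately show ?thesis
    by (simp add: gap_def G_def flip: A_def) (simp add: algebra_simps)
qed

section \<open>Monotone decrease, sublinear rate and linear contraction of the energy\<close>

lemma step_gap_nonneg: "((a (Suc t))\<^sup>2 - a (Suc t)) * gap (x t) \<le> (a t)\<^sup>2 * gap (x t)"
proof (cases "t = 0")
  \<comment> \<open>Both coefficients vanish here; the sign of \<open>gap (x 0)\<close> is
    unknown.\<close>
  case True
  then show ?thesis using a_0 a_1 by simp
next
  case False
  then show ?thesis
    using a_step[of t] gap_nonneg[of t] by (intro mult_right_mono) auto
qed

lemma real_energy_decreasing: "real_energy (Suc t) \<le> real_energy t"
proof -
  have "1 / (2 * \<gamma>) * (norm (z t - xs))\<^sup>2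
      \<le> (1 + a t * \<gamma> * \<mu>\<^sub>g) / (2 * \<gamma>) * (norm (z t - xs))\<^sup>2"
    using gamma_pos a_nonneg[of t] mug_nonneg by (intro mult_right_mono divide_right_mono) auto
  with energy_step[of t] step_gap_nonneg[of t] show ?thesis
    by (simp add: real_energy_def)
qed

lemma real_energy_0: "real_energy 0 = 1 / (2 * \<gamma>) * (norm (x 0 - xs))\<^sup>2"
  using a_0 start by (simp add: real_energy_def)

lemma real_energy_le_initial: "real_energy t \<le> real_energy 0"
  by (induction t) (auto intro: order_trans[OF real_energy_decreasing])

lemma gap_bound:
  assumes "t \<ge> 1"
  shows "gap (x t) \<le> (norm (x 0 - xs))\<^sup>2 / (2 * \<gamma> * (a t)\<^sup>2)"
proof -
  have "0 \<le> (1 + a t * \<gamma> * \<mu>\<^sub>g) / (2 * \<gamma>) * (norm (z t - xs))\<^sup>2"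
    using gamma_pos a_nonneg[of t] mug_nonneg by simp
  then have "(a t)\<^sup>2 * gap (x t) \<le> 1 / (2 * \<gamma>) * (norm (x 0 - xs))\<^sup>2"
    using real_energy_le_initial[of t] real_energy_0 by (simp add: real_energy_def)
  moreover have "a t > 0"
    using a_ge_1[OF assms] by simp
  ultimately show ?thesis
    using gamma_pos by (simp add: field_simps)
qed

text \<open>With s = sqrt (\<mu> / L), (1 + s) times the bound of \<open>energy_step\<close> is
  compared term by term with the energy: A s^2 \<ge> s handles the distance and (1 + s) (A^2 - A)
  \<le> A^2 the gap, which is nonnegative as t \<ge> 1.\<close>

lemma real_energy_contraction:
  assumes mu: "\<mu>\<^sub>g > 0" and gamma: "\<gamma> = 1 / L\<^sub>f" and t: "t \<ge> 1"
    and a: "a t = a_sharp L\<^sub>f \<mu>\<^sub>g" "a (Suc t) = a_sharp L\<^sub>f \<mu>\<^sub>g"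
  shows "real_energy (Suc t) \<le> 1 / (1 + sqrt (\<mu>\<^sub>g / L\<^sub>f)) * real_energy t"
proof -
  define s where "s = sqrt (\<mu>\<^sub>g / L\<^sub>f)"
  define A where "A = a_sharp L\<^sub>f \<mu>\<^sub>g"
  define N where "N = 1 / (2 * \<gamma>) * (norm (z t - xs))\<^sup>2"
  have s: "s > 0" "s\<^sup>2 = \<mu>\<^sub>g / L\<^sub>f"
    using mu L_pos by (auto simp: s_def)
  have A: "A = max (1 / s) 1"
    by (simp add: A_def a_sharp_def s_def real_sqrt_divide)
  have N: "N \<ge> 0"
    using gamma_pos by (simp add: N_def)
  have As: "A * s \<ge> 1"
    using s(1) by (simp add: A max_def field_simps)
  have "A * s\<^sup>2 \<ge> s"
    using mult_right_mono[OF As, of s] s(1) by (simp add: power2_eq_square mult.assoc)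
  then have "(1 + s) * N \<le> (1 + A * s\<^sup>2) * N"
    using N by (intro mult_right_mono) auto
  moreover have "(1 + s) * (A\<^sup>2 - A) \<le> A\<^sup>2"
  \<comment> \<open>These are the two branches of the maximum: A = 1 / s or A = 1.\<close>
  proof (cases "s \<le> 1")
    case True
    then have "A * s = 1" using s(1) by (simp add: A max_def field_simps)
    then have "(1 + s) * (A\<^sup>2 - A) = A\<^sup>2 - 1"
      by algebra
    then show ?thesis by simp
  next
    case False
    then have "A = 1" using s(1) by (simp add: A max_def field_simps)
    then show ?thesis by simp
  qed
  then have "(1 + s) * (A\<^sup>2 - A) * gap (x t) \<le> A\<^sup>2 * gap (x t)"
    by (rule mult_right_mono) (rule gap_nonneg[OF t])
  moreover have "real_energy t = (1 + A * s\<^sup>2) * N + A\<^sup>2 * gap (x t)"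
  proof -
    have "real_energy t = (1 + A * (\<gamma> * \<mu>\<^sub>g)) * N + A\<^sup>2 * gap (x t)"
      by (simp add: real_energy_def N_def a mult.assoc flip: A_def)
    also have "\<gamma> * \<mu>\<^sub>g = s\<^sup>2"
      by (simp add: gamma s)
    finally show ?thesis .
  qed
  moreover have "(1 + s) * real_energy (Suc t) \<le> (1 + s) * (N + (A\<^sup>2 - A) * gap (x t))"
    using energy_step[of t] s(1) by (intro mult_left_mono) (auto simp: N_def A_def a)
  ultimately have "(1 + s) * real_energy (Suc t) \<le> real_energy t"
    by (simp add: distrib_left mult.assoc)
  then show ?thesis
    using s(1) by (simp add: field_simps flip: s_def)
qed

lemma real_energy_linear_decay:
  assumes "\<mu>\<^sub>g > 0" "T \<ge> 1" "\<gamma> = 1 / L\<^sub>f" and a: "\<forall>t\<ge>T. a t = a_sharp L\<^sub>f \<mu>\<^sub>g" and "t \<ge> T"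
  shows "real_energy t \<le> (1 / (1 + sqrt (\<mu>\<^sub>g / L\<^sub>f))) ^ (t - T) * real_energy T"
  using \<open>t \<ge> T\<close>
proof (induction t rule: dec_induct)
  case (step t)
  let ?q = "1 / (1 + sqrt (\<mu>\<^sub>g / L\<^sub>f))"
  have "real_energy (Suc t) \<le> ?q * real_energy t"
    using assms step by (intro real_energy_contraction) auto
  also have "\<dots> \<le> ?q * (?q ^ (t - T) * real_energy T)"
    using step assms L_pos by (intro mult_left_mono) auto
  finally show ?case
    using step by (simp add: Suc_diff_le)
qed simp

end

subsection \<open>Coefficient sequences\<close>

text \<open>Completing the square turns the left side into (2 b - 1)^2 \<le> 1 + 4 c^2, and b \<ge>
  1 makes 2 b - 1 nonnegative.\<close>

lemma coefficient_step_iff: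
  fixes b c :: real
  assumes "b \<ge> 1"
  shows "b\<^sup>2 - b \<le> c\<^sup>2 \<longleftrightarrow> b \<le> (1 + sqrt (1 + 4 * c\<^sup>2)) / 2"
proof -
  have "b \<le> (1 + sqrt (1 + 4 * c\<^sup>2)) / 2 \<longleftrightarrow> 2 * b - 1 \<le> sqrt (1 + 4 * c\<^sup>2)"
    by (simp add: field_simps)
  also have "\<dots> \<longleftrightarrow> (2 * b - 1)\<^sup>2 \<le> 1 + 4 * c\<^sup>2"
    using assms real_sqrt_le_iff[of "(2 * b - 1)\<^sup>2" "1 + 4 * c\<^sup>2"] by simp
  also have "\<dots> \<longleftrightarrow> b\<^sup>2 - b \<le> c\<^sup>2"
    unfolding power2_eq_square by (simp add: algebra_simps) linarith
  finally show ?thesis ..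
qed

text \<open>In the recursive case sqrt (1 + 4 b^2) \<ge> 2 b, so each step adds at least
  1/2.\<close>

lemma coefficients_lower_bound:
  assumes b: "half_coefficients b \<or> recursive_coefficients b" and t: "t \<ge> 1"
  shows "b t \<ge> (real t + 1) / 2"
proof -
  have "b (Suc n) \<ge> (real (Suc n) + 1) / 2" if "recursive_coefficients b" for n
  proof (induction n)
    case 0
    have "b (0 + 1) = (1 + sqrt (1 + 4 * (b 0)\<^sup>2)) / 2" "b 0 = 0"
      using that unfolding recursive_coefficients_def by blast+
    then show ?case by simp
  next
    case (Suc n)
    have "2 * b (Suc n) = sqrt ((2 * b (Suc n))\<^sup>2)"
      unfolding real_sqrt_abs using Suc by simp
    also have "\<dots> \<le> sqrt (1 + 4 * (b (Suc n))\<^sup>2)"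
      by (simp add: power_mult_distrib)
    finally have "2 * b (Suc n) \<le> sqrt (1 + 4 * (b (Suc n))\<^sup>2)" .
    moreover have "b (Suc n + 1) = (1 + sqrt (1 + 4 * (b (Suc n))\<^sup>2)) / 2"
      using that unfolding recursive_coefficients_def by blast
    ultimately show ?case
      using Suc by simp
  qed
  from this[of "t - 1"] b t show ?thesis
    by (auto simp: half_coefficients_def)
qed

lemma apgd_coefficientsI:
  assumes b: "half_coefficients b \<or> recursive_coefficients b"
  shows "apgd_coefficients b"
proof -
  have b0: "b 0 = 0"
    using b by (auto simp: half_coefficients_def recursive_coefficients_def)
  have b1: "b t \<ge> 1" if "t \<ge> 1" for t
    using coefficients_lower_bound[OF b that] that by simp
  have "(b (Suc t))\<^sup>2 - b (Suc t) \<le> (b t)\<^sup>2" for t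
    using b
  proof
    assume "half_coefficients b"
    then have S: "b (Suc t) = (real t + 2) / 2" and t: "t \<noteq> 0 \<Longrightarrow> b t = (real t + 1) / 2"
      by (auto simp: half_coefficients_def)
    show ?thesis
    \<comment> \<open>The formula would give 1/2 at t = 0, where the coefficient is 0. For t > 0 the
      left side is ((t + 1)^2 - 1) / 4.\<close>
    proof (cases "t = 0")
      case True
      then show ?thesis using S by simp
    next
      case False
      show ?thesis
        unfolding S t[OF False] by (simp add: power2_eq_square field_simps)
    qed
  next
    assume "recursive_coefficients b"
    then show ?thesis
      using b1[of "Suc t"] by (subst coefficient_step_iff) (auto simp: recursive_coefficients_def)
  qed
  with b0 b1 show ?thesis by (simp add: apgd_coefficients_def)
qed

subsection \<open>Iteration complexity\<close>

lemma linear_decay_reaches: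
  fixes E :: "nat \<Rightarrow> ereal" and s K \<epsilon> :: real
  assumes s: "s > 0" and \<epsilon>: "\<epsilon> > 0" and K: "K > 0"
    and decay: "\<And>t. t \<ge> T \<Longrightarrow> E t \<le> ereal ((1 / (1 + s)) ^ (t - T) * K)"
    and k: "ln (K / \<epsilon>) / ln (1 + s) \<le> real k"
  shows "E (T + k) \<le> ereal \<epsilon>"
proof -
  have "ln (K / \<epsilon>) \<le> ln ((1 + s) ^ k)"
    using k s by (simp add: ln_realpow field_simps)
  then have "K / \<epsilon> \<le> (1 + s) ^ k"
    using s \<epsilon> K by (subst (asm) ln_le_cancel_iff) auto
  then have "(1 / (1 + s)) ^ k * K \<le> \<epsilon>"
    using s \<epsilon> by (simp add: field_simps)
  with decay[of "T + k"] show ?thesis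
    by (simp add: order_trans)
qed

text \<open>About T + ln (K / \<epsilon>) / ln (1 + s) + 1 iterations suffice; any slope c above 1 /
  ln (1 + s) absorbs the additive constants once \<epsilon> is small.\<close>

lemma eventually_iterations_to_reach_le:
  fixes E :: "nat \<Rightarrow> ereal" and s K c :: real
  assumes s: "s > 0" and c: "c * ln (1 + s) > 1" and K: "K > 0"
    and decay: "\<And>t. t \<ge> T \<Longrightarrow> E t \<le> ereal ((1 / (1 + s)) ^ (t - T) * K)"
  shows "\<forall>\<^sub>F \<epsilon> in at_right 0. real (iterations_to_reach E \<epsilon>) \<le> c * ln (1 / \<epsilon>)"
proof -
  define l where "l = ln (1 + s)"
  have l: "l > 0" using s by (simp add: l_def)
  have d: "c - 1 / l > 0"
    using c l by (simp add: field_simps l_def)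
  have "filterlim (\<lambda>\<epsilon>::real. ln (1 / \<epsilon>)) at_top (at_right 0)"
    by real_asymp
  then have ev: "\<forall>\<^sub>F \<epsilon> in at_right 0. ln (1 / \<epsilon>) \<ge> M" for M :: real
    by (simp add: filterlim_at_top)
  have "\<forall>\<^sub>F \<epsilon> in at_right 0. \<epsilon> > (0::real)"
    by (rule eventually_at_right_less)
  \<comment> \<open>The first threshold makes ln (K / \<epsilon>) nonnegative, so that rounding up
    to a natural number costs at most 1; the second lets the excess slope c - 1 / l pay for the
    constants.\<close>
  with ev[of "- ln K"] ev[of "(real T + 1 + ln K / l) / (c - 1 / l)"] show ?thesis
  proof eventually_elim
    case (elim \<epsilon>)
    define k where "k = nat \<lceil>ln (K / \<epsilon>) / l\<rceil>"
    have ln: "ln (K / \<epsilon>) = ln K + ln (1 / \<epsilon>)"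
      using K elim by (simp add: ln_div)
    have "E (T + k) \<le> ereal \<epsilon>"
      using elim by (intro linear_decay_reaches[OF s _ K decay])
        (auto simp: k_def l_def real_nat_ceiling_ge)
    then have "iterations_to_reach E \<epsilon> \<le> T + k"
      unfolding iterations_to_reach_def by (rule Least_le)
    moreover have "0 \<le> ln (K / \<epsilon>) / l"
      using elim l by (simp add: ln)
    then have "real k \<le> ln (K / \<epsilon>) / l + 1"
      unfolding k_def by linarith
    ultimately have "real (iterations_to_reach E \<epsilon>) \<le> real T + 1 + ln K / l + ln (1 / \<epsilon>) / l"
      by (simp add: ln add_divide_distrib)
    also have "\<dots> \<le> c * ln (1 / \<epsilon>)"
      using elim(2) d by (simp add: pos_divide_le_eq algebra_simps)
    finally show ?case .
  qed
qed

context apgd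
begin

text \<open>The maximum with 1 gives a positive constant also when the energy at T vanishes.\<close>
lemma energy_linear_decay:
  assumes "\<mu>\<^sub>g > 0" "T \<ge> 1" "\<gamma> = 1 / L\<^sub>f" "\<forall>t\<ge>T. a t = a_sharp L\<^sub>f \<mu>\<^sub>g" "t \<ge> T"
  shows "energy f g \<mu>\<^sub>g xs \<gamma> a x z t
    \<le> ereal ((1 / (1 + sqrt (\<mu>\<^sub>g / L\<^sub>f))) ^ (t - T) * max 1 (real_energy T))"
proof -
  have "real_energy t \<le> (1 / (1 + sqrt (\<mu>\<^sub>g / L\<^sub>f))) ^ (t - T) * real_energy T"
    using assms by (rule real_energy_linear_decay)
  also have "\<dots> \<le> (1 / (1 + sqrt (\<mu>\<^sub>g / L\<^sub>f))) ^ (t - T) * max 1 (real_energy T)"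
    using mug_nonneg L_pos by (intro mult_left_mono) auto
  finally show ?thesis by (simp add: energy_eq)
qed

text \<open>Ensures that the \<open>LEAST\<close> in \<open>iterations_to_reach\<close> is attained,
  so that it is a genuine iteration count.\<close>

lemma energy_reaches:
  assumes "\<mu>\<^sub>g > 0" "T \<ge> 1" "\<gamma> = 1 / L\<^sub>f" "\<forall>t\<ge>T. a t = a_sharp L\<^sub>f \<mu>\<^sub>g" "\<epsilon> > 0"
  shows "\<exists>t. energy f g \<mu>\<^sub>g xs \<gamma> a x z t \<le> ereal \<epsilon>"
proof
  show "energy f g \<mu>\<^sub>g xs \<gamma> a x z
    (T + nat \<lceil>ln (max 1 (real_energy T) / \<epsilon>) / ln (1 + sqrt (\<mu>\<^sub>g / L\<^sub>f))\<rceil>) \<le> ereal \<epsilon>"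
    using assms L_pos
    by (intro linear_decay_reaches[OF _ _ _ energy_linear_decay]) (auto simp: real_nat_ceiling_ge)
qed

lemma eventually_iterations_le:
  assumes "\<mu>\<^sub>g > 0" "T \<ge> 1" "\<gamma> = 1 / L\<^sub>f" "\<forall>t\<ge>T. a t = a_sharp L\<^sub>f \<mu>\<^sub>g"
    and "c * ln (1 + sqrt (\<mu>\<^sub>g / L\<^sub>f)) > 1"
  shows "\<forall>\<^sub>F \<epsilon> in at_right 0.
    real (iterations_to_reach (energy f g \<mu>\<^sub>g xs \<gamma> a x z) \<epsilon>) \<le> c * ln (1 / \<epsilon>)"
  using assms L_pos
  by (intro eventually_iterations_to_reach_le[OF _ _ _ energy_linear_decay]) auto

lemma iterations_bigo:
  assumes "\<mu>\<^sub>g > 0" "T \<ge> 1" "\<gamma> = 1 / L\<^sub>f" "\<forall>t\<ge>T. a t = a_sharp L\<^sub>f \<mu>\<^sub>g"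
  shows "(\<lambda>\<epsilon>. real (iterations_to_reach (energy f g \<mu>\<^sub>g xs \<gamma> a x z) \<epsilon>))
    \<in> O[at_right 0](\<lambda>\<epsilon>. sqrt (L\<^sub>f / \<mu>\<^sub>g) * ln (1 / \<epsilon>))"
proof -
  define l where "l = ln (1 + sqrt (\<mu>\<^sub>g / L\<^sub>f))"
  have l: "l > 0" using assms L_pos by (auto simp: l_def intro!: ln_gt_zero)
  define r where "r = sqrt (L\<^sub>f / \<mu>\<^sub>g)"
  have r: "r > 0" using assms L_pos by (simp add: r_def)
  \<comment> \<open>Any slope above 1 / l would do. For a fixed problem the factor r is a constant,
    divided out in the final bound.\<close>
  have "2 / l * l > 1" using l by simp
  from eventually_iterations_le[OF assms this[unfolded l_def]]
  show ?thesis
  proof (intro bigoI[where c = "2 / l / r"], elim eventually_mono)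
    fix \<epsilon> assume "real (iterations_to_reach (energy f g \<mu>\<^sub>g xs \<gamma> a x z) \<epsilon>)
      \<le> 2 / ln (1 + sqrt (\<mu>\<^sub>g / L\<^sub>f)) * ln (1 / \<epsilon>)"
    also have "\<dots> \<le> 2 / l * \<bar>ln (1 / \<epsilon>)\<bar>"
      unfolding l_def[symmetric] using l by (intro mult_left_mono) auto
    finally show "norm (real (iterations_to_reach (energy f g \<mu>\<^sub>g xs \<gamma> a x z) \<epsilon>))
        \<le> 2 / l / r * norm (sqrt (L\<^sub>f / \<mu>\<^sub>g) * ln (1 / \<epsilon>))"
      using r by (simp add: abs_mult flip: r_def)
  qed
qed

text \<open>For s = sqrt (\<mu> / L) \<le> 1 one has ln (1 + s) \<ge> s / 2, so the slope 3 / s is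
  admissible, and 1 / s = sqrt (L / \<mu>). The range of \<epsilon> may depend on the problem; the
  constant 3 does not.\<close>

lemma eventually_iterations_le_uniform:
  assumes "\<mu>\<^sub>g > 0" "\<mu>\<^sub>g \<le> L\<^sub>f" "T \<ge> 1" "\<gamma> = 1 / L\<^sub>f" "\<forall>t\<ge>T. a t = a_sharp L\<^sub>f \<mu>\<^sub>g"
  shows "\<forall>\<^sub>F \<epsilon> in at_right 0. real (iterations_to_reach (energy f g \<mu>\<^sub>g xs \<gamma> a x z) \<epsilon>)
    \<le> 3 * (sqrt (L\<^sub>f / \<mu>\<^sub>g) * ln (1 / \<epsilon>))"
proof -
  define s where "s = sqrt (\<mu>\<^sub>g / L\<^sub>f)"
  have s: "0 < s" "s \<le> 1" using assms L_pos by (auto simp: s_def)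
  \<comment> \<open>The inequality ln u \<le> u - 1 at u = 1 / (1 + s).\<close>
  have "- ln (1 + s) \<le> 1 / (1 + s) - 1"
    using ln_le_minus_one[of "1 / (1 + s)"] s by (simp add: ln_div)
  also have "\<dots> \<le> - (s / 2)"
  proof -
    have "s * s \<le> s * 1"
      using s by (intro mult_left_mono) auto
    then show ?thesis using s by (simp add: field_simps)
  qed
  finally have "s / 2 \<le> ln (1 + s)" by simp
  then have "3 / s * (s / 2) \<le> 3 / s * ln (1 + s)"
    using s by (intro mult_left_mono) auto
  moreover have "3 / s * (s / 2) = 3 / 2"
    using s by simp
  ultimately have "3 / s * ln (1 + s) > 1"
    by linarith
  from eventually_iterations_le[OF assms(1,3,4,5) this[unfolded s_def]]
  show ?thesis
    by (simp add: real_sqrt_divide mult.assoc)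
qed

end

theorem corollary2p3:
  fixes f :: "'a::{real_inner, complete_space} \<Rightarrow> real"
    and f' :: "'a \<Rightarrow> 'a"
    and g :: "'a \<Rightarrow> ereal"
    and L\<^sub>f \<mu>\<^sub>f \<mu>\<^sub>g \<gamma> :: real
    and xs :: 'a
    and a :: "nat \<Rightarrow> real"
    and x y z :: "nat \<Rightarrow> 'a"
  assumes "apgd f f' g L\<^sub>f \<mu>\<^sub>f \<mu>\<^sub>g xs \<gamma> a x y z"
  shows
    \<comment> \<open>the remarks on the coefficients\<close>
    "(a 1 = 1 \<and>
      (\<forall>b :: nat \<Rightarrow> real. (\<forall>t\<ge>1. b t \<ge> 1) \<longrightarrow>
        (\<forall>t. (b (t + 1))\<^sup>2 - b (t + 1) \<le> (b t)\<^sup>2 \<longleftrightarrow> b (t + 1) \<le> (1 + sqrt (1 + 4 * (b t)\<^sup>2)) / 2)))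
    \<and>
     \<comment> \<open>(1)\<close>
     (energy f g \<mu>\<^sub>g xs \<gamma> a x z 0 = ereal (1 / (2 * \<gamma>) * (norm (x 0 - xs))\<^sup>2) \<and>
      (\<forall>t. energy f g \<mu>\<^sub>g xs \<gamma> a x z t \<le> energy f g \<mu>\<^sub>g xs \<gamma> a x z 0) \<and>
      (\<forall>t\<ge>1. objective f g (x t) - objective f g xs
               \<le> ereal ((norm (x 0 - xs))\<^sup>2 / (2 * \<gamma> * (a t)\<^sup>2))))
    \<and>
     \<comment> \<open>(2)\<close>
     ((\<forall>b. half_coefficients b \<or> recursive_coefficients b \<longrightarrow> apgd_coefficients b) \<and>
      (\<gamma> = 1 / L\<^sub>f \<and> (half_coefficients a \<or> recursive_coefficients a) \<longrightarrow>
        (\<forall>t\<ge>1. objective f g (x t) - objective f g xs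
                 \<le> ereal (2 * L\<^sub>f * (norm (x 0 - xs))\<^sup>2 / (real t + 1)\<^sup>2))))
    \<and>
     \<comment> \<open>(3)\<close>
     (\<forall>T. \<mu>\<^sub>g > 0 \<and> T \<ge> 1 \<and> \<gamma> = 1 / L\<^sub>f \<and> (\<forall>t\<ge>T. a t = a_sharp L\<^sub>f \<mu>\<^sub>g) \<longrightarrow>
        {u. is_arg_min (objective f g) (\<lambda>_. True) u} = {xs} \<and>
        (\<forall>t\<ge>T. energy f g \<mu>\<^sub>g xs \<gamma> a x z t
                 \<le> ereal ((1 / (1 + sqrt (\<mu>\<^sub>g / L\<^sub>f))) ^ (t - T)) * energy f g \<mu>\<^sub>g xs \<gamma> a x z T) \<and>
        (\<forall>\<epsilon>>0. \<exists>t. energy f g \<mu>\<^sub>g xs \<gamma> a x z t \<le> ereal \<epsilon>) \<and>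
        (\<lambda>\<epsilon>. real (iterations_to_reach (energy f g \<mu>\<^sub>g xs \<gamma> a x z) \<epsilon>))
          \<in> O[at_right 0](\<lambda>\<epsilon>. sqrt (L\<^sub>f / \<mu>\<^sub>g) * ln (1 / \<epsilon>)))
    \<and>
     \<comment> \<open>the complexity bound in (3) with a constant that is the same for all problems with
        mu_g at most L_f\<close>
     (\<exists>C>0. \<forall>(f :: 'a \<Rightarrow> real) f' g L\<^sub>f \<mu>\<^sub>f \<mu>\<^sub>g xs \<gamma> a x y z T.
        apgd f f' g L\<^sub>f \<mu>\<^sub>f \<mu>\<^sub>g xs \<gamma> a x y z \<and>
        0 < \<mu>\<^sub>g \<and> \<mu>\<^sub>g \<le> L\<^sub>f \<and> T \<ge> 1 \<and> \<gamma> = 1 / L\<^sub>f \<and> (\<forall>t\<ge>T. a t = a_sharp L\<^sub>f \<mu>\<^sub>g) \<longrightarrow>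
        (\<forall>\<^sub>F \<epsilon> in at_right 0.
           real (iterations_to_reach (energy f g \<mu>\<^sub>g xs \<gamma> a x z) \<epsilon>)
             \<le> C * (sqrt (L\<^sub>f / \<mu>\<^sub>g) * ln (1 / \<epsilon>))))"
proof -
  interpret apgd f f' g L\<^sub>f \<mu>\<^sub>f \<mu>\<^sub>g xs \<gamma> a x y z by fact
  \<comment> \<open>The general bound with \<open>a t\<close> replaced by its lower bound (t + 1) /
    2.\<close>
  have two: "gap (x t) \<le> 2 * L\<^sub>f * (norm (x 0 - xs))\<^sup>2 / (real t + 1)\<^sup>2"
    if gamma: "\<gamma> = 1 / L\<^sub>f" and a: "half_coefficients a \<or> recursive_coefficients a" and t: "t \<ge> 1" for t
  proof -
    have "gap (x t) \<le> (norm (x 0 - xs))\<^sup>2 / (2 * \<gamma> * (a t)\<^sup>2)"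
      by (rule gap_bound[OF t])
    also have "\<dots> \<le> (norm (x 0 - xs))\<^sup>2 / (2 * \<gamma> * ((real t + 1) / 2)\<^sup>2)"
      using coefficients_lower_bound[OF a t] gamma_pos
      by (intro divide_left_mono mult_left_mono power_mono mult_pos_pos) auto
    also have "\<dots> = 2 * L\<^sub>f * (norm (x 0 - xs))\<^sup>2 / (real t + 1)\<^sup>2"
      using L_pos by (simp add: gamma power_divide field_simps)
    finally show ?thesis .
  qed
  show ?thesis
  proof (intro conjI allI impI)
    show "a 1 = 1" by (rule a_1)
  next
    fix b :: "nat \<Rightarrow> real" and t
    assume "\<forall>t\<ge>1. 1 \<le> b t"
    then show "((b (t + 1))\<^sup>2 - b (t + 1) \<le> (b t)\<^sup>2) = (b (t + 1) \<le> (1 + sqrt (1 + 4 * (b t)\<^sup>2)) / 2)"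
      by (intro coefficient_step_iff) auto
  next
    fix T t assume "0 < \<mu>\<^sub>g \<and> 1 \<le> T \<and> \<gamma> = 1 / L\<^sub>f \<and> (\<forall>t\<ge>T. a t = a_sharp L\<^sub>f \<mu>\<^sub>g)" "t \<ge> T"
    then have "real_energy t \<le> (1 / (1 + sqrt (\<mu>\<^sub>g / L\<^sub>f))) ^ (t - T) * real_energy T"
      by (intro real_energy_linear_decay) auto
    then show "energy f g \<mu>\<^sub>g xs \<gamma> a x z t
        \<le> ereal ((1 / (1 + sqrt (\<mu>\<^sub>g / L\<^sub>f))) ^ (t - T)) * energy f g \<mu>\<^sub>g xs \<gamma> a x z T"
      by (simp add: energy_eq)
  next
    show "\<exists>C>0. \<forall>(f :: 'a \<Rightarrow> real) f' g L\<^sub>f \<mu>\<^sub>f \<mu>\<^sub>g xs \<gamma> a x y z T.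
        apgd f f' g L\<^sub>f \<mu>\<^sub>f \<mu>\<^sub>g xs \<gamma> a x y z \<and>
        0 < \<mu>\<^sub>g \<and> \<mu>\<^sub>g \<le> L\<^sub>f \<and> T \<ge> 1 \<and> \<gamma> = 1 / L\<^sub>f \<and> (\<forall>t\<ge>T. a t = a_sharp L\<^sub>f \<mu>\<^sub>g) \<longrightarrow>
        (\<forall>\<^sub>F \<epsilon> in at_right 0.
           real (iterations_to_reach (energy f g \<mu>\<^sub>g xs \<gamma> a x z) \<epsilon>)
             \<le> C * (sqrt (L\<^sub>f / \<mu>\<^sub>g) * ln (1 / \<epsilon>)))"
      by (intro exI[of _ 3] conjI allI impI, simp, elim conjE,
          rule apgd.eventually_iterations_le_uniform, assumption+)
  qed (use energy_eq real_energy_0 real_energy_le_initial objective_gap gap_bound two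
      apgd_coefficientsI unique_minimizer energy_reaches iterations_bigo in auto)
qed

end
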